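(* Let $\Gamma,\Delta$ be finite sets of formulas. The following conditions are equivalent: (i) the sequent $\Gamma\Rightarrow\Delta$ is derivable in ${\bf SC}_{\mathcal{TML}}$; (ii) there is a deduction in ${\bf ND}_{\mathcal{TML}}$ of the disjunction of the formulas in $\Delta$ from $\Gamma$.
   Context: Formulas are built from a denumerable set of propositional variables with connectives $\vee,\wedge$ (binary), $\neg,\square$ (unary). The symbol $\bot$ abbreviates $\neg p\wedge\square p$ for a fixed propositional variable $p$. The disjunction of the formulas in $\Delta$ is taken in any fixed order and bracketing, and is $\bot$ if $\Delta=\emptyset$. The calculus ${\bf SC}_{\mathcal{TML}}$ works with sequents $\Gamma\Rightarrow\Delta$, $\Gamma,\Delta$ finite (possibly empty) sets of formulas. It has the axioms $\alpha\Rightarrow\alpha$ and the following rules (premises / conclusion), where commas denote union of sets: Cut: $\Gamma\Rightarrow\Delta,\alpha$ and $\Gamma,\alpha\Rightarrow\Delta$ / $\Gamma\Rightarrow\Delta$. Weakening: $\Gamma\Rightarrow\Delta$ / $\Gamma,\alpha\Rightarrow\Delta$; and $\Gamma\Rightarrow\Delta$ / $\Gamma\Rightarrow\Delta,\alpha$. ($\vee\Rightarrow$) $\Gamma,\alpha\Rightarrow\Delta$ and $\Gamma,\beta\Rightarrow\Delta$ / $\Gamma,\alpha\vee\beta\Rightarrow\Delta$. ($\Rightarrow\vee$) $\Gamma\Rightarrow\Delta,\alpha,\beta$ / $\Gamma\Rightarrow\Delta,\alpha\vee\beta$. ($\neg\vee\Rightarrow$) $\Gamma,\neg\alpha,\neg\beta\Rightarrow\Delta$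 / $\Gamma,\neg(\alpha\vee\beta)\Rightarrow\Delta$. ($\Rightarrow\neg\vee$) $\Gamma\Rightarrow\Delta,\neg\alpha$ and $\Gamma\Rightarrow\Delta,\neg\beta$ / $\Gamma\Rightarrow\Delta,\neg(\alpha\vee\beta)$. ($\wedge\Rightarrow$) $\Gamma,\alpha,\beta\Rightarrow\Delta$ / $\Gamma,\alpha\wedge\beta\Rightarrow\Delta$. ($\Rightarrow\wedge$) $\Gamma\Rightarrow\Delta,\alpha$ and $\Gamma\Rightarrow\Delta,\beta$ / $\Gamma\Rightarrow\Delta,\alpha\wedge\beta$. ($\neg\wedge\Rightarrow$) $\Gamma,\neg\alpha\Rightarrow\Delta$ and $\Gamma,\neg\beta\Rightarrow\Delta$ / $\Gamma,\neg(\alpha\wedge\beta)\Rightarrow\Delta$. ($\Rightarrow\neg\wedge$) $\Gamma\Rightarrow\Delta,\neg\alpha,\neg\beta$ / $\Gamma\Rightarrow\Delta,\neg(\alpha\wedge\beta)$. ($\neg\neg\Rightarrow$) $\Gamma,\alpha\Rightarrow\Delta$ / $\Gamma,\neg\neg\alpha\Rightarrow\Delta$. ($\Rightarrow\neg\neg$) $\Gamma\Rightarrow\Delta,\alpha$ / $\Gamma\Rightarrow\Delta,\neg\neg\alpha$. ($\square\Rightarrow$)$_1$ $\Gamma,\alpha\Rightarrow\Delta$ / $\Gamma,\square\alpha\Rightarrow\Delta$. ($\square\Rightarrow$)$_2$ $\Gamma\Rightarrow\Delta,\neg\alpha$ / $\Gamma,\square\alpha\Rightarrow\Delta$. ($\Rightarrow\square$)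 $\Gamma\Rightarrow\Delta,\alpha$ and $\Gamma,\neg\alpha\Rightarrow\Delta$ / $\Gamma\Rightarrow\Delta,\square\alpha$. ($\neg\square\Rightarrow$) $\Gamma\Rightarrow\Delta,\alpha$ and $\Gamma,\neg\alpha\Rightarrow\Delta$ / $\Gamma,\neg\square\alpha\Rightarrow\Delta$. ($\Rightarrow\neg\square$)$_1$ $\Gamma,\alpha\Rightarrow\Delta$ / $\Gamma\Rightarrow\Delta,\neg\square\alpha$. ($\Rightarrow\neg\square$)$_2$ $\Gamma\Rightarrow\Delta,\neg\alpha$ / $\Gamma\Rightarrow\Delta,\neg\square\alpha$. The natural deduction system ${\bf ND}_{\mathcal{TML}}$: deductions are trees defined inductively. A single occurrence of an assumption $\phi$ is a deduction of $\phi$ from open assumption $\phi$. Deductions are extended by the following rules (premises / conclusion; "$\chi$ from $[\phi]$" means a subdeduction of $\chi$ in which occurrences of the open assumption $\phi$, possibly none, are closed by the rule): MA: (no premise) / $\phi\vee\neg\square\phi$. $\wedge$I: $\phi$, $\psi$ / $\phi\wedge\psi$. $\wedge$E$_1$: $\phi\wedge\psi$ / $\phi$. $\wedge$E$_2$: $\phi\wedge\psi$ / $\psi$. $\neg\wedge$I$_1$: $\neg\phi$ / $\neg(\phi\wedge\psi)$. $\neg\wedge$I$_2$: $\neg\psi$ / $\neg(\phi\wedge\psi)$. $\neg\wedge$E: $\neg(\phi\wedge\psi)$, $\chi$ from $[\neg\phi]$, $\chi$ from $[\neg\psi]$ / $\chi$. $\vee$I$_1$: $\phi$ / $\phi\vee\psi$.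 $\vee$I$_2$: $\psi$ / $\phi\vee\psi$. $\vee$E: $\phi\vee\psi$, $\chi$ from $[\phi]$, $\chi$ from $[\psi]$ / $\chi$. $\neg\vee$I: $\neg\phi$, $\neg\psi$ / $\neg(\phi\vee\psi)$. $\neg\vee$E$_1$: $\neg(\phi\vee\psi)$ / $\neg\phi$. $\neg\vee$E$_2$: $\neg(\phi\vee\psi)$ / $\neg\psi$. $\neg\neg$I: $\phi$ / $\neg\neg\phi$. $\neg\neg$E: $\neg\neg\phi$ / $\phi$. $\square$I$^*$: $\psi\vee\phi$, $\psi$ from $[\neg\phi]$ / $\psi\vee\square\phi$. $\square$E: $\square\phi$ / $\phi$. $\neg\square$I: $\neg\phi$ / $\neg\square\phi$. $\neg\square$E: $\neg\square\phi$, $\phi$ / $\neg\phi$. $\bot$I: $\neg\phi\wedge\square\phi$ / $\bot$. $\bot$E: $\bot$ / $\alpha$. A deduction of $\alpha$ from $\Gamma$ is a deduction with conclusion $\alpha$ all of whose open assumptions belong to $\Gamma$. *)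

theory Defs
  imports "HOL-Library.Multiset"
begin

datatype fm =
    Var nat
  | Neg fm          (\<open>\<^bold>\<not> _\<close> [80] 80)
  | Box fm          (\<open>\<box> _\<close> [80] 80)
  | And fm fm       (infixr \<open>\<^bold>\<and>\<close> 75)
  | Or fm fm        (infixr \<open>\<^bold>\<or>\<close> 70)

text \<open>The fixed propositional variable in the definition of falsum is an explicit parameter,
  so that statements hold for every choice of it.\<close>

definition Bot :: "nat \<Rightarrow> fm" where
  "Bot p = \<^bold>\<not> Var p \<^bold>\<and> \<box> Var p"

text \<open>\<open>is_disj p \<Delta> \<delta>\<close>: \<open>\<delta>\<close> is a disjunction of the formulas in \<open>\<Delta>\<close>, each taken exactly
  once, in some order and bracketing. The nonemptiness premises of \<open>join\<close> ensure that falsum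
  is only used for the empty set and not as an additional disjunct.\<close>

inductive is_disj :: "nat \<Rightarrow> fm set \<Rightarrow> fm \<Rightarrow> bool" for p :: nat where
  empty: "is_disj p {} (Bot p)"
| single: "is_disj p {\<alpha>} \<alpha>"
| join: "\<lbrakk>is_disj p A \<phi>; is_disj p B \<psi>; A \<noteq> {}; B \<noteq> {}; A \<inter> B = {}\<rbrakk>
         \<Longrightarrow> is_disj p (A \<union> B) (\<phi> \<^bold>\<or> \<psi>)"

lemma is_disj_exists:
  assumes "finite \<Delta>"
  shows "\<exists>\<delta>. is_disj p \<Delta> \<delta>"
  using assms
proof (induction \<Delta> rule: finite_induct)
  case empty
  then show ?case by (blast intro: is_disj.empty)
next
  case (insert \<alpha> A)
  then obtain \<delta> where "is_disj p A \<delta>" by blast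
  show ?case
  proof (cases "A = {}")
    case True
    then show ?thesis by (auto intro: is_disj.single)
  next
    case False
    have "is_disj p ({\<alpha>} \<union> A) (\<alpha> \<^bold>\<or> \<delta>)"
      using is_disj.single \<open>is_disj p A \<delta>\<close> False insert.hyps by (intro is_disj.join) auto
    then show ?thesis by auto
  qed
qed

text \<open>Derivable sequents. Both sides of a derivable sequent are automatically finite, see
  \<open>SC_finite\<close> below.\<close>

inductive SC :: "fm set \<Rightarrow> fm set \<Rightarrow> bool" where
  Ax: "SC {\<alpha>} {\<alpha>}"
| Cut: "\<lbrakk>SC \<Gamma> (insert \<alpha> \<Delta>); SC (insert \<alpha> \<Gamma>) \<Delta>\<rbrakk> \<Longrightarrow> SC \<Gamma> \<Delta>"
| WeakL: "SC \<Gamma> \<Delta> \<Longrightarrow> SC (insert \<alpha> \<Gamma>) \<Delta>"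
| WeakR: "SC \<Gamma> \<Delta> \<Longrightarrow> SC \<Gamma> (insert \<alpha> \<Delta>)"
| OrL: "\<lbrakk>SC (insert \<alpha> \<Gamma>) \<Delta>; SC (insert \<beta> \<Gamma>) \<Delta>\<rbrakk> \<Longrightarrow> SC (insert (\<alpha> \<^bold>\<or> \<beta>) \<Gamma>) \<Delta>"
| OrR: "SC \<Gamma> (insert \<alpha> (insert \<beta> \<Delta>)) \<Longrightarrow> SC \<Gamma> (insert (\<alpha> \<^bold>\<or> \<beta>) \<Delta>)"
| NegOrL: "SC (insert (\<^bold>\<not> \<alpha>) (insert (\<^bold>\<not> \<beta>) \<Gamma>)) \<Delta> \<Longrightarrow> SC (insert (\<^bold>\<not> (\<alpha> \<^bold>\<or> \<beta>)) \<Gamma>) \<Delta>"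
| NegOrR: "\<lbrakk>SC \<Gamma> (insert (\<^bold>\<not> \<alpha>) \<Delta>); SC \<Gamma> (insert (\<^bold>\<not> \<beta>) \<Delta>)\<rbrakk>
           \<Longrightarrow> SC \<Gamma> (insert (\<^bold>\<not> (\<alpha> \<^bold>\<or> \<beta>)) \<Delta>)"
| AndL: "SC (insert \<alpha> (insert \<beta> \<Gamma>)) \<Delta> \<Longrightarrow> SC (insert (\<alpha> \<^bold>\<and> \<beta>) \<Gamma>) \<Delta>"
| AndR: "\<lbrakk>SC \<Gamma> (insert \<alpha> \<Delta>); SC \<Gamma> (insert \<beta> \<Delta>)\<rbrakk> \<Longrightarrow> SC \<Gamma> (insert (\<alpha> \<^bold>\<and> \<beta>) \<Delta>)"
| NegAndL: "\<lbrakk>SC (insert (\<^bold>\<not> \<alpha>) \<Gamma>) \<Delta>; SC (insert (\<^bold>\<not> \<beta>) \<Gamma>) \<Delta>\<rbrakk>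
            \<Longrightarrow> SC (insert (\<^bold>\<not> (\<alpha> \<^bold>\<and> \<beta>)) \<Gamma>) \<Delta>"
| NegAndR: "SC \<Gamma> (insert (\<^bold>\<not> \<alpha>) (insert (\<^bold>\<not> \<beta>) \<Delta>)) \<Longrightarrow> SC \<Gamma> (insert (\<^bold>\<not> (\<alpha> \<^bold>\<and> \<beta>)) \<Delta>)"
| NegNegL: "SC (insert \<alpha> \<Gamma>) \<Delta> \<Longrightarrow> SC (insert (\<^bold>\<not> (\<^bold>\<not> \<alpha>)) \<Gamma>) \<Delta>"
| NegNegR: "SC \<Gamma> (insert \<alpha> \<Delta>) \<Longrightarrow> SC \<Gamma> (insert (\<^bold>\<not> (\<^bold>\<not> \<alpha>)) \<Delta>)"
| BoxL1: "SC (insert \<alpha> \<Gamma>) \<Delta> \<Longrightarrow> SC (insert (\<box> \<alpha>) \<Gamma>) \<Delta>"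
| BoxL2: "SC \<Gamma> (insert (\<^bold>\<not> \<alpha>) \<Delta>) \<Longrightarrow> SC (insert (\<box> \<alpha>) \<Gamma>) \<Delta>"
| BoxR: "\<lbrakk>SC \<Gamma> (insert \<alpha> \<Delta>); SC (insert (\<^bold>\<not> \<alpha>) \<Gamma>) \<Delta>\<rbrakk> \<Longrightarrow> SC \<Gamma> (insert (\<box> \<alpha>) \<Delta>)"
| NegBoxL: "\<lbrakk>SC \<Gamma> (insert \<alpha> \<Delta>); SC (insert (\<^bold>\<not> \<alpha>) \<Gamma>) \<Delta>\<rbrakk>
            \<Longrightarrow> SC (insert (\<^bold>\<not> (\<box> \<alpha>)) \<Gamma>) \<Delta>"
| NegBoxR1: "SC (insert \<alpha> \<Gamma>) \<Delta> \<Longrightarrow> SC \<Gamma> (insert (\<^bold>\<not> (\<box> \<alpha>)) \<Delta>)"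
| NegBoxR2: "SC \<Gamma> (insert (\<^bold>\<not> \<alpha>) \<Delta>) \<Longrightarrow> SC \<Gamma> (insert (\<^bold>\<not> (\<box> \<alpha>)) \<Delta>)"

lemma SC_finite: "SC \<Gamma> \<Delta> \<Longrightarrow> finite \<Gamma> \<and> finite \<Delta>"
  by (induction rule: SC.induct) auto

text \<open>\<open>ND p M \<phi>\<close>: there is a deduction tree with conclusion \<open>\<phi>\<close> whose occurrences of open
  assumptions form the multiset \<open>M\<close>. A rule that closes assumptions \<open>\<phi>\<close> in a subdeduction
  removes an arbitrary number \<open>n\<close> (possibly 0, not necessarily all) of the open occurrences
  of \<open>\<phi>\<close>.\<close>

inductive ND :: "nat \<Rightarrow> fm multiset \<Rightarrow> fm \<Rightarrow> bool" for p :: nat where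
  Assm: "ND p {#\<phi>#} \<phi>"
| MA: "ND p {#} (\<phi> \<^bold>\<or> \<^bold>\<not> (\<box> \<phi>))"
| AndI: "\<lbrakk>ND p A \<phi>; ND p B \<psi>\<rbrakk> \<Longrightarrow> ND p (A + B) (\<phi> \<^bold>\<and> \<psi>)"
| AndE1: "ND p A (\<phi> \<^bold>\<and> \<psi>) \<Longrightarrow> ND p A \<phi>"
| AndE2: "ND p A (\<phi> \<^bold>\<and> \<psi>) \<Longrightarrow> ND p A \<psi>"
| NegAndI1: "ND p A (\<^bold>\<not> \<phi>) \<Longrightarrow> ND p A (\<^bold>\<not> (\<phi> \<^bold>\<and> \<psi>))"
| NegAndI2: "ND p A (\<^bold>\<not> \<psi>) \<Longrightarrow> ND p A (\<^bold>\<not> (\<phi> \<^bold>\<and> \<psi>))"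
| NegAndE: "\<lbrakk>ND p A (\<^bold>\<not> (\<phi> \<^bold>\<and> \<psi>)); ND p (B + replicate_mset m (\<^bold>\<not> \<phi>)) \<chi>;
             ND p (C + replicate_mset n (\<^bold>\<not> \<psi>)) \<chi>\<rbrakk> \<Longrightarrow> ND p (A + B + C) \<chi>"
| OrI1: "ND p A \<phi> \<Longrightarrow> ND p A (\<phi> \<^bold>\<or> \<psi>)"
| OrI2: "ND p A \<psi> \<Longrightarrow> ND p A (\<phi> \<^bold>\<or> \<psi>)"
| OrE: "\<lbrakk>ND p A (\<phi> \<^bold>\<or> \<psi>); ND p (B + replicate_mset m \<phi>) \<chi>;
         ND p (C + replicate_mset n \<psi>) \<chi>\<rbrakk> \<Longrightarrow> ND p (A + B + C) \<chi>"
| NegOrI: "\<lbrakk>ND p A (\<^bold>\<not> \<phi>); ND p B (\<^bold>\<not> \<psi>)\<rbrakk> \<Longrightarrow> ND p (A + B) (\<^bold>\<not> (\<phi> \<^bold>\<or> \<psi>))"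
| NegOrE1: "ND p A (\<^bold>\<not> (\<phi> \<^bold>\<or> \<psi>)) \<Longrightarrow> ND p A (\<^bold>\<not> \<phi>)"
| NegOrE2: "ND p A (\<^bold>\<not> (\<phi> \<^bold>\<or> \<psi>)) \<Longrightarrow> ND p A (\<^bold>\<not> \<psi>)"
| NegNegI: "ND p A \<phi> \<Longrightarrow> ND p A (\<^bold>\<not> (\<^bold>\<not> \<phi>))"
| NegNegE: "ND p A (\<^bold>\<not> (\<^bold>\<not> \<phi>)) \<Longrightarrow> ND p A \<phi>"
| BoxI: "\<lbrakk>ND p A (\<psi> \<^bold>\<or> \<phi>); ND p (B + replicate_mset n (\<^bold>\<not> \<phi>)) \<psi>\<rbrakk>
         \<Longrightarrow> ND p (A + B) (\<psi> \<^bold>\<or> \<box> \<phi>)"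
| BoxE: "ND p A (\<box> \<phi>) \<Longrightarrow> ND p A \<phi>"
| NegBoxI: "ND p A (\<^bold>\<not> \<phi>) \<Longrightarrow> ND p A (\<^bold>\<not> (\<box> \<phi>))"
| NegBoxE: "\<lbrakk>ND p A (\<^bold>\<not> (\<box> \<phi>)); ND p B \<phi>\<rbrakk> \<Longrightarrow> ND p (A + B) (\<^bold>\<not> \<phi>)"
| BotI: "ND p A (\<^bold>\<not> \<phi> \<^bold>\<and> \<box> \<phi>) \<Longrightarrow> ND p A (Bot p)"
| BotE: "ND p A (Bot p) \<Longrightarrow> ND p A \<alpha>"

definition ND_from :: "nat \<Rightarrow> fm set \<Rightarrow> fm \<Rightarrow> bool" where
  "ND_from p \<Gamma> \<alpha> \<longleftrightarrow> (\<exists>M. set_mset M \<subseteq> \<Gamma> \<and> ND p M \<alpha>)"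

end

theory Submission
  imports Defs
begin

text \<open>
  From natural deduction to sequents: each rule of natural deduction, read as a sequent with a
  single formula on the right, is derivable with cut (\<open>SC_of_ND\<close>), and a disjunction on the right
  can be split into its disjuncts by cutting against \<open>SC_disj_members\<close>.

  From sequents to natural deduction: by induction on derivations, with a reading of the right-hand
  side that does not mention disjunctions.  A sequent \<open>\<Gamma> \<Rightarrow> \<Delta>\<close> is interpreted as a rule of proof by
  cases (\<open>cases_from\<close>): in every context extending \<open>\<Gamma>\<close>, a formula \<open>\<chi>\<close> that is deducible from each
  member of \<open>\<Delta>\<close> is deducible outright.  This is the elimination rule of the disjunction of \<open>\<Delta>\<close>,
  so order, bracketing and the empty case never have to be treated inside the induction; only at the
  end is \<open>\<chi>\<close> taken to be the given disjunction.  Under this reading each sequent rule becomes a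
  short deduction.  The rule introducing a box on the right is where the side formula of the
  box introduction rule matters: \<open>\<chi>\<close> itself takes the place of that side formula
  (\<open>ND_from_Box_cases\<close>).
\<close>

section \<open>Natural deduction over sets of assumptions\<close>

lemma ND_from_mono: "ND_from p \<Gamma> \<phi> \<Longrightarrow> \<Gamma> \<subseteq> \<Gamma>' \<Longrightarrow> ND_from p \<Gamma>' \<phi>"
  unfolding ND_from_def by blast

lemma ND_from_assm: "\<phi> \<in> \<Gamma> \<Longrightarrow> ND_from p \<Gamma> \<phi>"
  unfolding ND_from_def using ND.Assm[of p \<phi>] by (intro exI[of _ "{#\<phi>#}"]) simp

text \<open>A rule may discharge any number of occurrences; discharging all of them is what turns
  multisets of occurrences into sets of assumptions.\<close>

lemma ND_from_insertE:
  assumes "ND_from p (insert \<phi> \<Gamma>) \<chi>"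
  obtains B n where "set_mset B \<subseteq> \<Gamma>" "ND p (B + replicate_mset n \<phi>) \<chi>"
proof -
  obtain M where M: "set_mset M \<subseteq> insert \<phi> \<Gamma>" "ND p M \<chi>"
    using assms unfolding ND_from_def by blast
  let ?B = "filter_mset (\<lambda>x. x \<noteq> \<phi>) M"
  have "M = ?B + replicate_mset (count M \<phi>) \<phi>"
    by (rule multiset_eqI) auto
  then show thesis
    using that[of ?B "count M \<phi>"] M by auto
qed

lemma ND_from_unary:
  assumes "ND_from p \<Gamma> \<phi>" and "\<And>A. ND p A \<phi> \<Longrightarrow> ND p A \<psi>"
  shows "ND_from p \<Gamma> \<psi>"
  using assms unfolding ND_from_def by blast

lemma ND_from_single:
  assumes "\<And>A. ND p A \<phi> \<Longrightarrow> ND p A \<psi>"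
  shows "ND_from p {\<phi>} \<psi>"
  using ND_from_assm[OF singletonI] assms by (rule ND_from_unary)

lemma ND_from_binary:
  assumes "ND_from p \<Gamma> \<phi>" and "ND_from p \<Gamma> \<psi>"
    and "\<And>A B. ND p A \<phi> \<Longrightarrow> ND p B \<psi> \<Longrightarrow> ND p (A + B) \<chi>"
  shows "ND_from p \<Gamma> \<chi>"
proof -
  obtain A B where "set_mset A \<subseteq> \<Gamma>" "ND p A \<phi>" "set_mset B \<subseteq> \<Gamma>" "ND p B \<psi>"
    using assms(1,2) unfolding ND_from_def by blast
  then show ?thesis
    unfolding ND_from_def using assms(3) by (intro exI[of _ "A + B"]) auto
qed

lemma ND_from_OrE:
  assumes "ND_from p \<Gamma> (\<phi> \<^bold>\<or> \<psi>)"
    and "ND_from p (insert \<phi> \<Gamma>) \<chi>" and "ND_from p (insert \<psi> \<Gamma>) \<chi>"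
  shows "ND_from p \<Gamma> \<chi>"
proof -
  obtain A where A: "set_mset A \<subseteq> \<Gamma>" "ND p A (\<phi> \<^bold>\<or> \<psi>)"
    using assms(1) unfolding ND_from_def by blast
  obtain B m where B: "set_mset B \<subseteq> \<Gamma>" "ND p (B + replicate_mset m \<phi>) \<chi>"
    using assms(2) by (rule ND_from_insertE)
  obtain C n where C: "set_mset C \<subseteq> \<Gamma>" "ND p (C + replicate_mset n \<psi>) \<chi>"
    using assms(3) by (rule ND_from_insertE)
  show ?thesis
    unfolding ND_from_def using ND.OrE[OF A(2) B(2) C(2)] A B C
    by (intro exI[of _ "A + B + C"]) auto
qed

lemma ND_from_NegAndE:
  assumes "ND_from p \<Gamma> (\<^bold>\<not> (\<phi> \<^bold>\<and> \<psi>))"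
    and "ND_from p (insert (\<^bold>\<not> \<phi>) \<Gamma>) \<chi>" and "ND_from p (insert (\<^bold>\<not> \<psi>) \<Gamma>) \<chi>"
  shows "ND_from p \<Gamma> \<chi>"
proof -
  obtain A where A: "set_mset A \<subseteq> \<Gamma>" "ND p A (\<^bold>\<not> (\<phi> \<^bold>\<and> \<psi>))"
    using assms(1) unfolding ND_from_def by blast
  obtain B m where B: "set_mset B \<subseteq> \<Gamma>" "ND p (B + replicate_mset m (\<^bold>\<not> \<phi>)) \<chi>"
    using assms(2) by (rule ND_from_insertE)
  obtain C n where C: "set_mset C \<subseteq> \<Gamma>" "ND p (C + replicate_mset n (\<^bold>\<not> \<psi>)) \<chi>"
    using assms(3) by (rule ND_from_insertE)
  show ?thesis
    unfolding ND_from_def using ND.NegAndE[OF A(2) B(2) C(2)] A B C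
    by (intro exI[of _ "A + B + C"]) auto
qed

lemma ND_from_BoxI:
  assumes "ND_from p \<Gamma> (\<psi> \<^bold>\<or> \<phi>)" and "ND_from p (insert (\<^bold>\<not> \<phi>) \<Gamma>) \<psi>"
  shows "ND_from p \<Gamma> (\<psi> \<^bold>\<or> \<box> \<phi>)"
proof -
  obtain A where A: "set_mset A \<subseteq> \<Gamma>" "ND p A (\<psi> \<^bold>\<or> \<phi>)"
    using assms(1) unfolding ND_from_def by blast
  obtain B n where B: "set_mset B \<subseteq> \<Gamma>" "ND p (B + replicate_mset n (\<^bold>\<not> \<phi>)) \<psi>"
    using assms(2) by (rule ND_from_insertE)
  show ?thesis
    unfolding ND_from_def using ND.BoxI[OF A(2) B(2)] A B
    by (intro exI[of _ "A + B"]) auto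
qed

text \<open>Substituting a deduction for an assumption is a proof by cases on \<open>\<phi> \<or> \<phi>\<close>: disjunction
  elimination replaces the usual induction on deduction trees.\<close>

lemma ND_from_cut:
  assumes "ND_from p \<Gamma> \<phi>" and "ND_from p (insert \<phi> \<Gamma>) \<chi>"
  shows "ND_from p \<Gamma> \<chi>"
  using ND_from_OrE[OF ND_from_unary[OF assms(1) ND.OrI1] assms(2) assms(2)] .

lemma ND_from_subst:
  assumes "ND_from p (insert \<phi> \<Gamma>) \<chi>" and "ND_from p (insert \<psi> \<Gamma>) \<phi>"
  shows "ND_from p (insert \<psi> \<Gamma>) \<chi>"
  using assms(2) by (rule ND_from_cut) (auto intro: ND_from_mono[OF assms(1)])

lemma ND_from_explode:
  assumes "ND_from p \<Gamma> (\<box> \<phi>)" and "ND_from p \<Gamma> (\<^bold>\<not> \<phi>)"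
  shows "ND_from p \<Gamma> \<chi>"
  using assms(2,1) by (rule ND_from_binary) (blast intro: ND.AndI ND.BotI ND.BotE)

text \<open>The box rule with conclusion \<open>\<chi>\<close> arbitrary: \<open>\<chi>\<close> serves as the side formula of the introduction
  rule, and the resulting \<open>\<chi> \<or> \<box>\<phi>\<close> is eliminated at once.\<close>

lemma ND_from_Box_cases:
  assumes "ND_from p \<Gamma> (\<chi> \<^bold>\<or> \<phi>)" and "ND_from p (insert (\<^bold>\<not> \<phi>) \<Gamma>) \<chi>"
    and "ND_from p (insert (\<box> \<phi>) \<Gamma>) \<chi>"
  shows "ND_from p \<Gamma> \<chi>"
  using ND_from_BoxI[OF assms(1,2)] _ assms(3) by (rule ND_from_OrE) (simp add: ND_from_assm)

section \<open>From sequents to natural deduction\<close>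

text \<open>The elimination rule of the disjunction of \<open>\<Delta>\<close>.  The quantification over larger contexts
  \<open>\<Gamma>'\<close> makes the notion stable under weakening on the left.\<close>

definition cases_from :: "nat \<Rightarrow> fm set \<Rightarrow> fm set \<Rightarrow> bool" where
  "cases_from p \<Gamma> \<Delta> \<longleftrightarrow>
    (\<forall>\<Gamma>' \<chi>. \<Gamma> \<subseteq> \<Gamma>' \<longrightarrow> (\<forall>\<alpha>\<in>\<Delta>. ND_from p (insert \<alpha> \<Gamma>') \<chi>) \<longrightarrow> ND_from p \<Gamma>' \<chi>)"

lemma cases_fromI:
  assumes "\<And>\<Gamma>' \<chi>. \<Gamma> \<subseteq> \<Gamma>' \<Longrightarrow> (\<And>\<alpha>. \<alpha> \<in> \<Delta> \<Longrightarrow> ND_from p (insert \<alpha> \<Gamma>') \<chi>) \<Longrightarrow> ND_from p \<Gamma>' \<chi>"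
  shows "cases_from p \<Gamma> \<Delta>"
  using assms unfolding cases_from_def by blast

lemma cases_fromD:
  assumes "cases_from p \<Gamma> \<Delta>" and "\<Gamma> \<subseteq> \<Gamma>'"
    and "\<And>\<alpha>. \<alpha> \<in> \<Delta> \<Longrightarrow> ND_from p (insert \<alpha> \<Gamma>') \<chi>"
  shows "ND_from p \<Gamma>' \<chi>"
  using assms unfolding cases_from_def by blast

lemma cases_fromD_insert:
  assumes "cases_from p (insert \<phi> \<Gamma>) \<Delta>" and "\<Gamma> \<subseteq> \<Gamma>'"
    and "\<And>\<alpha>. \<alpha> \<in> \<Delta> \<Longrightarrow> ND_from p (insert \<alpha> \<Gamma>') \<chi>"
  shows "ND_from p (insert \<phi> \<Gamma>') \<chi>"
  using assms(1)
proof (rule cases_fromD)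
  fix \<alpha> assume "\<alpha> \<in> \<Delta>"
  then show "ND_from p (insert \<alpha> (insert \<phi> \<Gamma>')) \<chi>"
    using assms(3) by (blast intro: ND_from_mono)
qed (use assms(2) in auto)

text \<open>Most sequent rules follow one of four schemes.  A one-premise left rule replaces assumptions
  by a formula from which they are deducible; a one-premise right rule replaces alternatives by a
  formula deducible from either.  Rules with a single active formula are covered by taking
  \<open>\<phi>\<close> and \<open>\<psi>\<close> equal.\<close>

lemma cases_from_left:
  assumes "cases_from p (insert \<phi> (insert \<psi> \<Gamma>)) \<Delta>"
    and "ND_from p {\<theta>} \<phi>" and "ND_from p {\<theta>} \<psi>"
  shows "cases_from p (insert \<theta> \<Gamma>) \<Delta>"
proof (rule cases_fromI)
  fix \<Gamma>' \<chi>
  assume sub: "insert \<theta> \<Gamma> \<subseteq> \<Gamma>'" and *: "\<And>\<alpha>. \<alpha> \<in> \<Delta> \<Longrightarrow> ND_from p (insert \<alpha> \<Gamma>') \<chi>"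
  show "ND_from p \<Gamma>' \<chi>"
  proof (rule ND_from_cut)
    show "ND_from p \<Gamma>' \<psi>"
      using assms(3) by (rule ND_from_mono) (use sub in simp)
    show "ND_from p (insert \<psi> \<Gamma>') \<chi>"
    proof (rule ND_from_cut)
      show "ND_from p (insert \<psi> \<Gamma>') \<phi>"
        using assms(2) by (rule ND_from_mono) (use sub in simp)
      show "ND_from p (insert \<phi> (insert \<psi> \<Gamma>')) \<chi>"
        using assms(1)
      proof (rule cases_fromD)
        fix \<alpha> assume "\<alpha> \<in> \<Delta>"
        then show "ND_from p (insert \<alpha> (insert \<phi> (insert \<psi> \<Gamma>'))) \<chi>"
          by (rule ND_from_mono[OF *]) auto
      qed (use sub in auto)
    qed
  qed
qed

lemma cases_from_right:
  assumes "cases_from p \<Gamma> (insert \<phi> (insert \<psi> \<Delta>))"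
    and "ND_from p {\<phi>} \<theta>" and "ND_from p {\<psi>} \<theta>"
  shows "cases_from p \<Gamma> (insert \<theta> \<Delta>)"
proof (rule cases_fromI)
  fix \<Gamma>' \<chi>
  assume sub: "\<Gamma> \<subseteq> \<Gamma>'"
    and *: "\<And>\<alpha>. \<alpha> \<in> insert \<theta> \<Delta> \<Longrightarrow> ND_from p (insert \<alpha> \<Gamma>') \<chi>"
  have "ND_from p (insert \<phi> \<Gamma>') \<chi>"
    using * by (rule ND_from_subst) (use assms(2) in \<open>auto intro: ND_from_mono\<close>)
  moreover have "ND_from p (insert \<psi> \<Gamma>') \<chi>"
    using * by (rule ND_from_subst) (use assms(3) in \<open>auto intro: ND_from_mono\<close>)
  ultimately have "ND_from p (insert \<alpha> \<Gamma>') \<chi>" if "\<alpha> \<in> insert \<phi> (insert \<psi> \<Delta>)" for \<alpha>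
    using * that by blast
  with assms(1) sub show "ND_from p \<Gamma>' \<chi>"
    by (rule cases_fromD)
qed

text \<open>The right rules for \<open>\<and>\<close> and \<open>\<not>\<or>\<close> combine one alternative from each premise, so the two case
  distinctions are nested.\<close>

lemma cases_from_right2:
  assumes "cases_from p \<Gamma> (insert \<phi> \<Delta>)" and "cases_from p \<Gamma> (insert \<psi> \<Delta>)"
    and "ND_from p {\<phi>, \<psi>} \<theta>"
  shows "cases_from p \<Gamma> (insert \<theta> \<Delta>)"
proof (rule cases_fromI)
  fix \<Gamma>' \<chi>
  assume sub: "\<Gamma> \<subseteq> \<Gamma>'"
    and *: "\<And>\<alpha>. \<alpha> \<in> insert \<theta> \<Delta> \<Longrightarrow> ND_from p (insert \<alpha> \<Gamma>') \<chi>"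
  have both: "ND_from p (insert \<psi> (insert \<phi> \<Gamma>')) \<chi>"
  proof (rule ND_from_subst)
    show "ND_from p (insert \<theta> (insert \<phi> \<Gamma>')) \<chi>"
      using *[of \<theta>] by (auto intro: ND_from_mono)
    show "ND_from p (insert \<psi> (insert \<phi> \<Gamma>')) \<theta>"
      using assms(3) by (rule ND_from_mono) auto
  qed
  have first: "ND_from p (insert \<phi> \<Gamma>') \<chi>"
    using assms(2)
  proof (rule cases_fromD)
    fix \<alpha> assume "\<alpha> \<in> insert \<psi> \<Delta>"
    then show "ND_from p (insert \<alpha> (insert \<phi> \<Gamma>')) \<chi>"
      using both * by (blast intro: ND_from_mono)
  qed (use sub in blast)
  show "ND_from p \<Gamma>' \<chi>"
    using assms(1) sub by (rule cases_fromD) (use first * in blast)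
qed

text \<open>The left rules for \<open>\<or>\<close> and \<open>\<not>\<and>\<close> are the corresponding natural deduction eliminations.\<close>

lemma cases_from_left2:
  assumes "cases_from p (insert \<phi> \<Gamma>) \<Delta>" and "cases_from p (insert \<psi> \<Gamma>) \<Delta>"
    and elim: "\<And>\<Gamma>' \<chi>. \<theta> \<in> \<Gamma>' \<Longrightarrow> ND_from p (insert \<phi> \<Gamma>') \<chi> \<Longrightarrow> ND_from p (insert \<psi> \<Gamma>') \<chi>
      \<Longrightarrow> ND_from p \<Gamma>' \<chi>"
  shows "cases_from p (insert \<theta> \<Gamma>) \<Delta>"
proof (rule cases_fromI)
  fix \<Gamma>' \<chi>
  assume sub: "insert \<theta> \<Gamma> \<subseteq> \<Gamma>'" and *: "\<And>\<alpha>. \<alpha> \<in> \<Delta> \<Longrightarrow> ND_from p (insert \<alpha> \<Gamma>') \<chi>"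
  show "ND_from p \<Gamma>' \<chi>"
  proof (rule elim)
    show "ND_from p (insert \<phi> \<Gamma>') \<chi>"
      using assms(1) _ * by (rule cases_fromD_insert) (use sub in simp)
    show "ND_from p (insert \<psi> \<Gamma>') \<chi>"
      using assms(2) _ * by (rule cases_fromD_insert) (use sub in simp)
  qed (use sub in simp)
qed

lemma cases_from_SC:
  assumes "SC \<Gamma> \<Delta>"
  shows "cases_from p \<Gamma> \<Delta>"
  using assms
proof (induction rule: SC.induct)
  case (Ax \<alpha>)
  show ?case
    by (rule cases_fromI) (metis insert_absorb insert_subset singletonI)
next
  case (Cut \<Gamma> \<alpha> \<Delta>)
  show ?case
  proof (rule cases_fromI)
    fix \<Gamma>' \<chi>
    assume sub: "\<Gamma> \<subseteq> \<Gamma>'" and *: "\<And>\<alpha>. \<alpha> \<in> \<Delta> \<Longrightarrow> ND_from p (insert \<alpha> \<Gamma>') \<chi>"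
    \<comment> \<open>The cut formula is just one more case, settled by the other premise.\<close>
    have "ND_from p (insert \<alpha> \<Gamma>') \<chi>"
      using Cut.IH(2) sub * by (rule cases_fromD_insert)
    then have "ND_from p (insert \<beta> \<Gamma>') \<chi>" if "\<beta> \<in> insert \<alpha> \<Delta>" for \<beta>
      using * that by blast
    with Cut.IH(1) sub show "ND_from p \<Gamma>' \<chi>"
      by (rule cases_fromD)
  qed
next
  case (WeakL \<Gamma> \<Delta> \<alpha>)
  then show ?case unfolding cases_from_def by blast
next
  case (WeakR \<Gamma> \<Delta> \<alpha>)
  then show ?case unfolding cases_from_def by blast
next
  case (OrL \<alpha> \<Gamma> \<Delta> \<beta>)
  show ?case
    using OrL.IH by (rule cases_from_left2) (rule ND_from_OrE[OF ND_from_assm])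
next
  case (OrR \<Gamma> \<alpha> \<beta> \<Delta>)
  show ?case
    using OrR.IH by (rule cases_from_right) (rule ND_from_single, erule ND.OrI1 ND.OrI2)+
next
  case (NegOrL \<alpha> \<beta> \<Gamma> \<Delta>)
  show ?case
    using NegOrL.IH by (rule cases_from_left) (rule ND_from_single, erule ND.NegOrE1 ND.NegOrE2)+
next
  case (NegOrR \<Gamma> \<alpha> \<Delta> \<beta>)
  show ?case
    using NegOrR.IH by (rule cases_from_right2)
      (rule ND_from_binary[OF ND_from_assm ND_from_assm ND.NegOrI]; simp)
next
  case (AndL \<alpha> \<beta> \<Gamma> \<Delta>)
  show ?case
    using AndL.IH by (rule cases_from_left) (rule ND_from_single, erule ND.AndE1 ND.AndE2)+
next
  case (AndR \<Gamma> \<alpha> \<Delta> \<beta>)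
  show ?case
    using AndR.IH by (rule cases_from_right2)
      (rule ND_from_binary[OF ND_from_assm ND_from_assm ND.AndI]; simp)
next
  case (NegAndL \<alpha> \<Gamma> \<Delta> \<beta>)
  show ?case
    using NegAndL.IH by (rule cases_from_left2) (rule ND_from_NegAndE[OF ND_from_assm])
next
  case (NegAndR \<Gamma> \<alpha> \<beta> \<Delta>)
  show ?case
    using NegAndR.IH by (rule cases_from_right) (rule ND_from_single, erule ND.NegAndI1 ND.NegAndI2)+
next
  case (NegNegL \<alpha> \<Gamma> \<Delta>)
  have *: "ND_from p {\<^bold>\<not> (\<^bold>\<not> \<alpha>)} \<alpha>"
    by (rule ND_from_single) (rule ND.NegNegE)
  show ?case
    by (rule cases_from_left[OF _ * *]) (simp add: NegNegL.IH)
next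
  case (NegNegR \<Gamma> \<alpha> \<Delta>)
  have *: "ND_from p {\<alpha>} (\<^bold>\<not> (\<^bold>\<not> \<alpha>))"
    by (rule ND_from_single) (rule ND.NegNegI)
  show ?case
    by (rule cases_from_right[OF _ * *]) (simp add: NegNegR.IH)
next
  case (BoxL1 \<alpha> \<Gamma> \<Delta>)
  have *: "ND_from p {\<box> \<alpha>} \<alpha>"
    by (rule ND_from_single) (rule ND.BoxE)
  show ?case
    by (rule cases_from_left[OF _ * *]) (simp add: BoxL1.IH)
next
  case (BoxL2 \<Gamma> \<alpha> \<Delta>)
  show ?case
  proof (rule cases_fromI)
    fix \<Gamma>' \<chi>
    assume sub: "insert (\<box> \<alpha>) \<Gamma> \<subseteq> \<Gamma>'"
      and *: "\<And>\<alpha>. \<alpha> \<in> \<Delta> \<Longrightarrow> ND_from p (insert \<alpha> \<Gamma>') \<chi>"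
    have "ND_from p (insert (\<^bold>\<not> \<alpha>) \<Gamma>') \<chi>"
      by (rule ND_from_explode[of _ _ \<alpha>]; rule ND_from_assm) (use sub in auto)
    then have "ND_from p (insert \<beta> \<Gamma>') \<chi>" if "\<beta> \<in> insert (\<^bold>\<not> \<alpha>) \<Delta>" for \<beta>
      using * that by blast
    with BoxL2.IH _ show "ND_from p \<Gamma>' \<chi>"
      by (rule cases_fromD) (use sub in blast)
  qed
next
  case (BoxR \<Gamma> \<alpha> \<Delta>)
  show ?case
  proof (rule cases_fromI)
    fix \<Gamma>' \<chi>
    assume sub: "\<Gamma> \<subseteq> \<Gamma>'"
      and *: "\<And>\<beta>. \<beta> \<in> insert (\<box> \<alpha>) \<Delta> \<Longrightarrow> ND_from p (insert \<beta> \<Gamma>') \<chi>"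
    show "ND_from p \<Gamma>' \<chi>"
    proof (rule ND_from_Box_cases)
      show "ND_from p \<Gamma>' (\<chi> \<^bold>\<or> \<alpha>)"
        using BoxR.IH(1) sub by (rule cases_fromD)
          (use * in \<open>auto intro: ND_from_unary[OF _ ND.OrI1]
            ND_from_unary[OF ND_from_assm ND.OrI2]\<close>)
      show "ND_from p (insert (\<^bold>\<not> \<alpha>) \<Gamma>') \<chi>"
        using BoxR.IH(2) sub by (rule cases_fromD_insert) (use * in blast)
      show "ND_from p (insert (\<box> \<alpha>) \<Gamma>') \<chi>"
        using * by blast
    qed
  qed
next
  case (NegBoxL \<Gamma> \<alpha> \<Delta>)
  show ?case
  proof (rule cases_fromI)
    fix \<Gamma>' \<chi>
    assume sub: "insert (\<^bold>\<not> (\<box> \<alpha>)) \<Gamma> \<subseteq> \<Gamma>'"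
      and *: "\<And>\<alpha>. \<alpha> \<in> \<Delta> \<Longrightarrow> ND_from p (insert \<alpha> \<Gamma>') \<chi>"
    have "ND_from p (insert (\<^bold>\<not> \<alpha>) \<Gamma>') \<chi>"
      using NegBoxL.IH(2) _ * by (rule cases_fromD_insert) (use sub in blast)
    moreover have "ND_from p (insert \<alpha> \<Gamma>') (\<^bold>\<not> \<alpha>)"
      by (rule ND_from_binary[OF ND_from_assm ND_from_assm ND.NegBoxE]) (use sub in auto)
    ultimately have "ND_from p (insert \<alpha> \<Gamma>') \<chi>"
      by (rule ND_from_subst)
    then have "ND_from p (insert \<beta> \<Gamma>') \<chi>" if "\<beta> \<in> insert \<alpha> \<Delta>" for \<beta>
      using * that by blast
    with NegBoxL.IH(1) _ show "ND_from p \<Gamma>' \<chi>"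
      by (rule cases_fromD) (use sub in blast)
  qed
next
  case (NegBoxR1 \<alpha> \<Gamma> \<Delta>)
  show ?case
  proof (rule cases_fromI)
    fix \<Gamma>' \<chi>
    assume sub: "\<Gamma> \<subseteq> \<Gamma>'"
      and *: "\<And>\<beta>. \<beta> \<in> insert (\<^bold>\<not> (\<box> \<alpha>)) \<Delta> \<Longrightarrow> ND_from p (insert \<beta> \<Gamma>') \<chi>"
    have "ND_from p \<Gamma>' (\<alpha> \<^bold>\<or> \<^bold>\<not> (\<box> \<alpha>))"
      unfolding ND_from_def using ND.MA[of p \<alpha>] by (intro exI[of _ "{#}"]) simp
    moreover have "ND_from p (insert \<alpha> \<Gamma>') \<chi>"
      using NegBoxR1.IH sub by (rule cases_fromD_insert) (use * in blast)
    ultimately show "ND_from p \<Gamma>' \<chi>"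
      by (rule ND_from_OrE) (use * in blast)
  qed
next
  case (NegBoxR2 \<Gamma> \<alpha> \<Delta>)
  have *: "ND_from p {\<^bold>\<not> \<alpha>} (\<^bold>\<not> (\<box> \<alpha>))"
    by (rule ND_from_single) (rule ND.NegBoxI)
  show ?case
    by (rule cases_from_right[OF _ * *]) (simp add: NegBoxR2.IH)
qed

lemma ND_disj_from_member:
  assumes "is_disj p \<Delta> \<delta>" and "\<alpha> \<in> \<Delta>"
  shows "ND_from p (insert \<alpha> \<Gamma>) \<delta>"
  using assms
proof (induction rule: is_disj.induct)
  case (single \<beta>)
  then show ?case by (simp add: ND_from_assm)
next
  case (join A \<phi> B \<psi>)
  then consider "ND_from p (insert \<alpha> \<Gamma>) \<phi>" | "ND_from p (insert \<alpha> \<Gamma>) \<psi>"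
    by blast
  then show ?case
    by cases (erule ND_from_unary, erule ND.OrI1 ND.OrI2)+
qed simp

section \<open>From natural deduction to sequents\<close>

lemma SC_weaken_left:
  assumes "finite \<Gamma>'" and "SC \<Gamma> \<Delta>"
  shows "SC (\<Gamma>' \<union> \<Gamma>) \<Delta>"
  using assms by (induction rule: finite_induct) (auto intro: SC.WeakL)

lemma SC_weaken_right:
  assumes "finite \<Delta>'" and "SC \<Gamma> \<Delta>"
  shows "SC \<Gamma> (\<Delta>' \<union> \<Delta>)"
  using assms by (induction rule: finite_induct) (auto intro: SC.WeakR)

lemma SC_weaken:
  assumes "SC \<Gamma> \<Delta>" and "\<Gamma> \<subseteq> \<Gamma>'" and "\<Delta> \<subseteq> \<Delta>'" and "finite \<Gamma>'" and "finite \<Delta>'"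
  shows "SC \<Gamma>' \<Delta>'"
  using SC_weaken_right[OF assms(5) SC_weaken_left[OF assms(4,1)]] assms(2,3)
  by (simp add: Un_absorb2)

lemma SC_member: "\<alpha> \<in> \<Gamma> \<Longrightarrow> \<alpha> \<in> \<Delta> \<Longrightarrow> finite \<Gamma> \<Longrightarrow> finite \<Delta> \<Longrightarrow> SC \<Gamma> \<Delta>"
  using SC_weaken[OF SC.Ax[of \<alpha>]] by auto

lemma SC_trans:
  assumes "SC \<Gamma> {\<phi>}" and "SC (insert \<phi> \<Gamma>) \<Delta>"
  shows "SC \<Gamma> \<Delta>"
proof (rule SC.Cut)
  show "SC \<Gamma> (insert \<phi> \<Delta>)"
    using SC_finite[OF assms(1)] SC_finite[OF assms(2)] by (intro SC_weaken[OF assms(1)]) auto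
qed (rule assms(2))

text \<open>Covers falsum itself, which is the instance where \<open>\<phi>\<close> is a variable, as well as the premise of
  its introduction rule.\<close>

lemma SC_contradiction:
  assumes "finite \<Gamma>" and "finite \<Delta>"
  shows "SC (insert (\<^bold>\<not> \<phi> \<^bold>\<and> \<box> \<phi>) \<Gamma>) \<Delta>"
proof -
  have "SC (insert (\<^bold>\<not> \<phi>) \<Gamma>) (insert (\<^bold>\<not> \<phi>) \<Delta>)"
    using assms by (auto intro: SC_member)
  then have "SC (insert (\<box> \<phi>) (insert (\<^bold>\<not> \<phi>) \<Gamma>)) \<Delta>"
    by (rule SC.BoxL2)
  then show ?thesis
    by (intro SC.AndL) (simp add: insert_commute)
qed

text \<open>Stating the claim for every finite \<open>\<Gamma>\<close> containing the open assumptions builds weakening into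
  the induction: all premises of a rule can share one \<open>\<Gamma>\<close>, enlarged only by the discharged formula.\<close>

lemma SC_of_ND:
  assumes "ND p M \<phi>" and "set_mset M \<subseteq> \<Gamma>" and "finite \<Gamma>"
  shows "SC \<Gamma> {\<phi>}"
  using assms
proof (induction arbitrary: \<Gamma> rule: ND.induct)
  case (Assm \<phi>)
  then show ?case by (auto intro: SC_member)
next
  case (MA \<phi>)
  have "SC \<Gamma> {\<^bold>\<not> (\<box> \<phi>), \<phi>}"
    using MA by (intro SC.NegBoxR1 SC_member[of \<phi>]) auto
  then show ?case by (intro SC.OrR) (simp add: insert_commute)
next
  case (AndI A \<phi> B \<psi>)
  then show ?case by (auto intro: SC.AndR)
next
  case (AndE1 A \<phi> \<psi>)
  have "SC (insert (\<phi> \<^bold>\<and> \<psi>) \<Gamma>) {\<phi>}"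
    using AndE1.prems by (intro SC.AndL SC_member[of \<phi>]) auto
  with AndE1.IH[OF AndE1.prems] show ?case by (rule SC_trans)
next
  case (AndE2 A \<phi> \<psi>)
  have "SC (insert (\<phi> \<^bold>\<and> \<psi>) \<Gamma>) {\<psi>}"
    using AndE2.prems by (intro SC.AndL SC_member[of \<psi>]) auto
  with AndE2.IH[OF AndE2.prems] show ?case by (rule SC_trans)
next
  case (NegAndI1 A \<phi> \<psi>)
  show ?case
    using SC.WeakR[OF NegAndI1.IH[OF NegAndI1.prems], of "\<^bold>\<not> \<psi>"]
    by (intro SC.NegAndR) (simp add: insert_commute)
next
  case (NegAndI2 A \<psi> \<phi>)
  show ?case
    using SC.WeakR[OF NegAndI2.IH[OF NegAndI2.prems], of "\<^bold>\<not> \<phi>"] by (rule SC.NegAndR)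
next
  case (NegAndE A \<phi> \<psi> B m \<chi> C n)
  have "SC \<Gamma> {\<^bold>\<not> (\<phi> \<^bold>\<and> \<psi>)}"
    using NegAndE.prems by (intro NegAndE.IH) auto
  moreover have "SC (insert (\<^bold>\<not> \<phi>) \<Gamma>) {\<chi>}"
    by (rule NegAndE.IH(2)) (use NegAndE.prems in auto)
  moreover have "SC (insert (\<^bold>\<not> \<psi>) \<Gamma>) {\<chi>}"
    by (rule NegAndE.IH(3)) (use NegAndE.prems in auto)
  ultimately show ?case by (rule SC_trans[OF _ SC.NegAndL])
next
  case (OrI1 A \<phi> \<psi>)
  show ?case
    using SC.WeakR[OF OrI1.IH[OF OrI1.prems], of \<psi>] by (intro SC.OrR) (simp add: insert_commute)
next
  case (OrI2 A \<psi> \<phi>)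
  show ?case
    using SC.WeakR[OF OrI2.IH[OF OrI2.prems], of \<phi>] by (rule SC.OrR)
next
  case (OrE A \<phi> \<psi> B m \<chi> C n)
  have "SC \<Gamma> {\<phi> \<^bold>\<or> \<psi>}"
    using OrE.prems by (intro OrE.IH) auto
  moreover have "SC (insert \<phi> \<Gamma>) {\<chi>}"
    by (rule OrE.IH(2)) (use OrE.prems in auto)
  moreover have "SC (insert \<psi> \<Gamma>) {\<chi>}"
    by (rule OrE.IH(3)) (use OrE.prems in auto)
  ultimately show ?case by (rule SC_trans[OF _ SC.OrL])
next
  case (NegOrI A \<phi> B \<psi>)
  then show ?case by (auto intro: SC.NegOrR)
next
  case (NegOrE1 A \<phi> \<psi>)
  have "SC (insert (\<^bold>\<not> (\<phi> \<^bold>\<or> \<psi>)) \<Gamma>) {\<^bold>\<not> \<phi>}"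
    using NegOrE1.prems by (intro SC.NegOrL SC_member[of "\<^bold>\<not> \<phi>"]) auto
  with NegOrE1.IH[OF NegOrE1.prems] show ?case by (rule SC_trans)
next
  case (NegOrE2 A \<phi> \<psi>)
  have "SC (insert (\<^bold>\<not> (\<phi> \<^bold>\<or> \<psi>)) \<Gamma>) {\<^bold>\<not> \<psi>}"
    using NegOrE2.prems by (intro SC.NegOrL SC_member[of "\<^bold>\<not> \<psi>"]) auto
  with NegOrE2.IH[OF NegOrE2.prems] show ?case by (rule SC_trans)
next
  case (NegNegI A \<phi>)
  then show ?case by (auto intro: SC.NegNegR)
next
  case (NegNegE A \<phi>)
  have "SC (insert (\<^bold>\<not> (\<^bold>\<not> \<phi>)) \<Gamma>) {\<phi>}"
    using NegNegE.prems by (intro SC.NegNegL SC_member[of \<phi>]) auto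
  with NegNegE.IH[OF NegNegE.prems] show ?case by (rule SC_trans)
next
  case (BoxI A \<psi> \<phi> B n)
  have "SC \<Gamma> {\<psi> \<^bold>\<or> \<phi>}"
    using BoxI.prems by (intro BoxI.IH) auto
  moreover have "SC (insert (\<psi> \<^bold>\<or> \<phi>) \<Gamma>) {\<phi>, \<psi>}"
    using BoxI.prems by (auto intro: SC.OrL SC_member)
  ultimately have "SC \<Gamma> {\<phi>, \<psi>}" by (rule SC_trans)
  moreover have "SC (insert (\<^bold>\<not> \<phi>) \<Gamma>) {\<psi>}"
    by (rule BoxI.IH(2)) (use BoxI.prems in auto)
  ultimately have "SC \<Gamma> {\<box> \<phi>, \<psi>}" by (rule SC.BoxR)
  then show ?case by (intro SC.OrR) (simp add: insert_commute)
next
  case (BoxE A \<phi>)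
  have "SC (insert (\<box> \<phi>) \<Gamma>) {\<phi>}"
    using BoxE.prems by (intro SC.BoxL1 SC_member[of \<phi>]) auto
  with BoxE.IH[OF BoxE.prems] show ?case by (rule SC_trans)
next
  case (NegBoxI A \<phi>)
  then show ?case by (auto intro: SC.NegBoxR2)
next
  case (NegBoxE A \<phi> B)
  have "SC \<Gamma> {\<^bold>\<not> (\<box> \<phi>)}" and \<phi>: "SC \<Gamma> {\<phi>}"
    using NegBoxE.prems by (auto intro: NegBoxE.IH)
  have "SC \<Gamma> {\<phi>, \<^bold>\<not> \<phi>}"
    using SC.WeakR[OF \<phi>, of "\<^bold>\<not> \<phi>"] by (simp add: insert_commute)
  then have "SC (insert (\<^bold>\<not> (\<box> \<phi>)) \<Gamma>) {\<^bold>\<not> \<phi>}"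
    using NegBoxE.prems by (intro SC.NegBoxL SC_member[of "\<^bold>\<not> \<phi>" "insert _ _"]) auto
  with \<open>SC \<Gamma> {\<^bold>\<not> (\<box> \<phi>)}\<close> show ?case by (rule SC_trans)
next
  case (BotI A \<phi>)
  have "SC (insert (\<^bold>\<not> \<phi> \<^bold>\<and> \<box> \<phi>) \<Gamma>) {Bot p}"
    using BotI.prems by (intro SC_contradiction) auto
  with BotI.IH[OF BotI.prems] show ?case by (rule SC_trans)
next
  case (BotE A \<alpha>)
  have "SC (insert (Bot p) \<Gamma>) {\<alpha>}"
    unfolding Bot_def using BotE.prems by (intro SC_contradiction) auto
  with BotE.IH[OF BotE.prems] show ?case by (rule SC_trans)
qed

text \<open>A cut against this sequent splits the disjunction on the right-hand side.\<close>

lemma SC_disj_members: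
  assumes "is_disj p \<Delta> \<delta>" and "finite \<Delta>" and "finite \<Gamma>"
  shows "SC (insert \<delta> \<Gamma>) \<Delta>"
  using assms
proof (induction rule: is_disj.induct)
  case empty
  then show ?case unfolding Bot_def by (intro SC_contradiction)
next
  case (single \<alpha>)
  then show ?case by (auto intro: SC_member)
next
  case (join A \<phi> B \<psi>)
  have "SC (insert \<phi> \<Gamma>) (B \<union> A)" "SC (insert \<psi> \<Gamma>) (A \<union> B)"
    using join.prems by (auto intro!: SC_weaken_right join.IH)
  then show ?case by (auto simp: Un_commute intro: SC.OrL)
qed

section \<open>Equivalence of the two calculi\<close>

theorem theorem7p3:
  fixes p :: nat and \<Gamma> \<Delta> :: "fm set" and \<delta> :: fm
  assumes "finite \<Gamma>" and "finite \<Delta>"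
    and "is_disj p \<Delta> \<delta>"
  shows "SC \<Gamma> \<Delta> \<longleftrightarrow> ND_from p \<Gamma> \<delta>"
proof
  assume "SC \<Gamma> \<Delta>"
  from cases_from_SC[OF this] order_refl ND_disj_from_member[OF assms(3)]
  show "ND_from p \<Gamma> \<delta>"
    by (rule cases_fromD)
next
  assume "ND_from p \<Gamma> \<delta>"
  then have "SC \<Gamma> {\<delta>}"
    unfolding ND_from_def using SC_of_ND assms(1) by blast
  then show "SC \<Gamma> \<Delta>"
    using SC_disj_members[OF assms(3,2,1)] by (rule SC_trans)
qed

end
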